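(* There is a function $\delta$ with $\delta(\varepsilon) = \mathcal{O}_{\varepsilon \to 0}\left(\frac{\log(\log(1/\varepsilon))}{\sqrt{\log(1/\varepsilon)}}\right)$ such that the following holds for every $\varepsilon > 0$, every $n$ and every $w = (w(1),\ldots,w(n)) \in \mathbb{Z}^n$: if $\beta(w) \ge 2^{(1-\varepsilon)n}$, then $|w(2^{[n]})| \le 2^{\delta(\varepsilon) n}$.
   Context: For $X \subseteq [n]$ let $w(X) := \sum_{i \in X} w(i)$. Define $w(2^{[n]}) := \{ w(X) : X \subseteq [n]\}$ and $\beta(w) := \max_{v} |\{ X \subseteq [n] : w(X) = v\}|$. Logarithms are base 2. We write $f(\varepsilon) = \mathcal{O}_{\varepsilon \to 0}(g(\varepsilon))$ if there are $C > 0$ and $\varepsilon_0 > 0$ with $|f(\varepsilon)| \le C g(\varepsilon)$ for all $0 < \varepsilon < \varepsilon_0$. *)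

theory Defs
  imports Complex_Main "HOL-Library.Landau_Symbols"
begin

text \<open>
  A vector in \<open>\<int>\<^sup>n\<close> is represented by a function \<open>w :: nat \<Rightarrow> int\<close> together with \<open>n\<close>;
  only the values of \<open>w\<close> on \<open>{1..n}\<close> are used.
\<close>

definition weight :: "(nat \<Rightarrow> int) \<Rightarrow> nat set \<Rightarrow> int" where
  "weight w X = (\<Sum>i\<in>X. w i)"

definition subset_sums :: "nat \<Rightarrow> (nat \<Rightarrow> int) \<Rightarrow> int set" where
  "subset_sums n w = {weight w X | X. X \<subseteq> {1..n}}"

text \<open>The maximum is over all integers \<open>v\<close>; the counts are bounded by \<open>2 ^ n\<close>, so \<open>Max\<close> is
  applied to a finite nonempty set.\<close>

definition max_fibre :: "nat \<Rightarrow> (nat \<Rightarrow> int) \<Rightarrow> nat" where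
  "max_fibre n w = Max (range (\<lambda>v::int. card {X. X \<subseteq> {1..n} \<and> weight w X = v}))"

lemma finite_range_fibre_card:
  "finite (range (\<lambda>v::int. card {X. X \<subseteq> {1..n} \<and> weight w X = v}))"
proof (rule finite_subset)
  show "range (\<lambda>v::int. card {X. X \<subseteq> {1..n} \<and> weight w X = v}) \<subseteq> {..card (Pow {1..n})}"
    by (auto intro!: card_mono simp del: card_Pow)
qed simp

end

theory Submission
  imports Defs "HOL-Analysis.Convex" "HOL-Real_Asymp.Real_Asymp" "HOL-Library.Function_Algebras"
    "HOL-Library.Set_Algebras" "HOL-Library.FuncSet" "HOL-Library.Indicator_Function"
begin

text \<open>
  Identify subsets of \<open>{1..n}\<close> with 0/1 vectors. Let \<open>A\<close> be a largest fibre of the weight, and let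
  \<open>B\<close> contain one subset for each attained weight. The weight is constant on the
  \<open>k\<close>-fold sumset \<open>kA\<close> and injective on \<open>B\<close>, hence
  \<open>|kA| |B| = |kA + B| \<le> (k + 2) ^ n\<close>. On the other hand \<open>|X + A| \<ge> ((k + 2) / (2 (k + 1))) ^ n |X| |A|\<close>
  for every \<open>X \<subseteq> {0..k} ^ n\<close>, by induction on the number of coordinates; iterating gives
  \<open>|kA| \<ge> (k + 1) ^ n (|A| / 2 ^ n) ^ k\<close>. Therefore
  \<open>|B| \<le> (1 + 1 / (k + 1)) ^ n 2 ^ (k \<epsilon> n)\<close>, and \<open>k \<approx> 1 / sqrt \<epsilon>\<close> yields \<open>\<delta>(\<epsilon>) = 3 sqrt \<epsilon>\<close>,
  which is far below the required bound.
\<close>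

section \<open>A one-dimensional convolution inequality\<close>

lemma sum_upto_mult_self:
  fixes x :: "nat \<Rightarrow> real"
  shows "2 * (\<Sum>r<k. x r * (\<Sum>i\<le>r. x i)) = (\<Sum>r<k. x r)\<^sup>2 + (\<Sum>r<k. (x r)\<^sup>2)"
  by (induction k) (auto simp: algebra_simps power2_eq_square lessThan_Suc_atMost[symmetric])

text \<open>The sums up to \<open>r\<close> and from \<open>r\<close> overlap exactly in
  \<open>x r\<close>, so together they give the total plus \<open>x r\<close>. This reduces the
  claim to \<open>sum_upto_mult_self\<close>.\<close>

lemma sum_from_mult_self:
  fixes x :: "nat \<Rightarrow> real"
  shows "2 * (\<Sum>r<k. x r * (\<Sum>i=r..<k. x i)) = (\<Sum>r<k. x r)\<^sup>2 + (\<Sum>r<k. (x r)\<^sup>2)"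
proof -
  have "(\<Sum>i\<le>r. x i) + (\<Sum>i=r..<k. x i) = (\<Sum>i<k. x i) + x r" if "r < k" for r
  proof -
    have "(\<Sum>i<k. x i) = (\<Sum>i<r. x i) + (\<Sum>i=r..<k. x i)"
      using sum.atLeastLessThan_concat[of 0 r k x] that by (simp add: lessThan_atLeast0)
    then show ?thesis by (simp add: lessThan_Suc_atMost[symmetric])
  qed
  then have "(\<Sum>r<k. x r * (\<Sum>i\<le>r. x i)) + (\<Sum>r<k. x r * (\<Sum>i=r..<k. x i))
      = (\<Sum>r<k. x r * ((\<Sum>i<k. x i) + x r))"
    unfolding sum.distrib[symmetric] distrib_left[symmetric] by (intro sum.cong) auto
  also have "\<dots> = (\<Sum>r<k. x r)\<^sup>2 + (\<Sum>r<k. (x r)\<^sup>2)"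
    by (simp add: distrib_left sum.distrib sum_distrib_right power2_eq_square)
  finally show ?thesis using sum_upto_mult_self[of x k] by linarith
qed

text \<open>The single-coordinate case of the sumset bound: \<open>x\<close>, \<open>b0\<close>,
  \<open>b1\<close> and \<open>t\<close> stand for scaled slice sizes of the two summands and of the
  sumset. The constant is sharp: both sides agree when \<open>x\<close> is constant,
  \<open>b0 = b1\<close> and every \<open>t i\<close> is \<open>x 0 * b0\<close>.\<close>

lemma sup_convolution_sum_ge:
  fixes x t :: "nat \<Rightarrow> real"
  assumes x: "\<And>i. i < k \<Longrightarrow> 0 \<le> x i" and b: "0 \<le> b0" "0 \<le> b1" and k: "0 < k"
    and t0: "\<And>i. i < k \<Longrightarrow> x i * b0 \<le> t i"
    and t1: "\<And>i. i < k \<Longrightarrow> x i * b1 \<le> t (Suc i)"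
  shows "real (k + 1) * (\<Sum>i<k. x i) * (b0 + b1) \<le> real (2 * k) * (\<Sum>i\<le>k. t i)"
proof -
  define S where "S = (\<Sum>i<k. x i)"
  define Q where "Q = (\<Sum>i<k. (x i)\<^sup>2)"
  define T where "T = (\<Sum>i\<le>k. t i)"
  \<comment> \<open>Slices up to \<open>r\<close> are bounded through \<open>b0\<close>, later ones
    through \<open>b1\<close>. Because \<open>b1\<close> shifts the index by one, \<open>x r\<close>
    can be used in both groups; this overlap produces the gain \<open>Q\<close> below.\<close>
  have split: "b0 * (\<Sum>i\<le>r. x i) + b1 * (\<Sum>i=r..<k. x i) \<le> T" if r: "r < k" for r
  proof -
    have "b0 * (\<Sum>i\<le>r. x i) \<le> (\<Sum>i\<le>r. t i)"
      unfolding sum_distrib_left using t0 r by (intro sum_mono) (auto simp: mult.commute)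
    moreover have "b1 * (\<Sum>i=r..<k. x i) \<le> (\<Sum>i=r..<k. t (Suc i))"
      unfolding sum_distrib_left using t1 by (intro sum_mono) (auto simp: mult.commute)
    moreover have "T = (\<Sum>i\<le>r. t i) + (\<Sum>i=r..<k. t (Suc i))"
      using sum.atLeastLessThan_concat[of 0 "Suc r" "Suc k" t] r
      unfolding T_def sum.shift_bounds_Suc_ivl[symmetric]
      by (simp add: lessThan_atLeast0 lessThan_Suc_atMost[symmetric] del: sum.op_ivl_Suc)
    ultimately show ?thesis by linarith
  qed
  have S0: "0 \<le> S" unfolding S_def using x by (intro sum_nonneg) auto
  show ?thesis
  proof (cases "S = 0")
    case True
    \<comment> \<open>Averaging is impossible with total weight zero, but then only
      \<open>0 \<le> T\<close> is required, and the split at \<open>0\<close> provides it.\<close>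
    have "0 \<le> b0 * (\<Sum>i\<le>0. x i) + b1 * (\<Sum>i=0..<k. x i)"
      using x b k by (intro add_nonneg_nonneg mult_nonneg_nonneg sum_nonneg) auto
    then have "0 \<le> T" using split[OF k] by linarith
    then show ?thesis using True by (simp add: S_def T_def)
  next
    case False
    \<comment> \<open>Average the split bounds over \<open>r\<close> with weights \<open>x r / S\<close>.\<close>
    have "(\<Sum>r<k. x r * (b0 * (\<Sum>i\<le>r. x i) + b1 * (\<Sum>i=r..<k. x i))) \<le> (\<Sum>r<k. x r * T)"
      using split x by (intro sum_mono mult_left_mono) auto
    also have "\<dots> = S * T" by (simp add: S_def sum_distrib_right)
    also have "(\<Sum>r<k. x r * (b0 * (\<Sum>i\<le>r. x i) + b1 * (\<Sum>i=r..<k. x i)))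
        = b0 * (\<Sum>r<k. x r * (\<Sum>i\<le>r. x i)) + b1 * (\<Sum>r<k. x r * (\<Sum>i=r..<k. x i))"
      by (simp add: distrib_left sum.distrib sum_distrib_left mult.left_commute)
    also have "\<dots> = b0 * ((S\<^sup>2 + Q) / 2) + b1 * ((S\<^sup>2 + Q) / 2)"
      using sum_upto_mult_self[of x k] sum_from_mult_self[of x k] unfolding S_def Q_def
      by (intro arg_cong2[of _ _ _ _ "(+)"] arg_cong2[of _ _ _ _ "(*)"] refl) auto
    finally have *: "(b0 + b1) * (S\<^sup>2 + Q) \<le> 2 * (S * T)" by (simp add: field_simps)
    \<comment> \<open>Cauchy-Schwarz: the diagonal \<open>Q\<close> is at least
      \<open>S\<^sup>2 / k\<close>, which is the source of the factor
      \<open>(k + 1) / k\<close>.\<close>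
    have cs: "S\<^sup>2 \<le> real k * Q"
      using sum_squared_le_sum_of_squares[of x "{..<k}"] by (simp add: S_def Q_def mult.commute)
    have "(real k + 1) * S\<^sup>2 * (b0 + b1) \<le> (real k * (S\<^sup>2 + Q)) * (b0 + b1)"
      using cs b by (intro mult_right_mono) (auto simp: algebra_simps)
    also have "\<dots> \<le> real k * (2 * (S * T))"
      using mult_left_mono[OF *, of "real k"] by (simp add: mult_ac)
    finally have "S * ((real k + 1) * S * (b0 + b1)) \<le> S * (2 * real k * T)"
      by (simp add: power2_eq_square mult_ac)
    then have "(real k + 1) * S * (b0 + b1) \<le> 2 * real k * T"
      using False S0 by simp
    then show ?thesis by (simp add: S_def T_def add.commute)
  qed
qed

section \<open>Sumsets in a box, by induction on the coordinates\<close>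

lemma card_eq_sum_slices:
  assumes "finite X" and "\<And>f. f \<in> X \<Longrightarrow> f p \<in> J" and "finite J"
  shows "card X = (\<Sum>j\<in>J. card {f \<in> X. f p = j})"
proof -
  have "X = (\<Union>j\<in>J. {f \<in> X. f p = j})" using assms by auto
  then have "card X = card (\<Union>j\<in>J. {f \<in> X. f p = j})" by simp
  also have "\<dots> = (\<Sum>j\<in>J. card {f \<in> X. f p = j})"
    using assms by (intro card_UN_disjoint) auto
  finally show ?thesis .
qed

text \<open>Coordinates outside \<open>I\<close> are frozen, so that slices need no re-indexing in the induction.\<close>

lemma card_box_sumset_ge:
  fixes X B :: "('a \<Rightarrow> nat) set"
  assumes "finite I" "0 < k" "finite X" "finite B"
    and "\<And>f i. f \<in> X \<Longrightarrow> i \<in> I \<Longrightarrow> f i < k"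
    and "\<And>f i. f \<in> B \<Longrightarrow> i \<in> I \<Longrightarrow> f i < 2"
    and "\<And>f g i. f \<in> X \<Longrightarrow> g \<in> X \<Longrightarrow> i \<notin> I \<Longrightarrow> f i = g i"
    and "\<And>f g i. f \<in> B \<Longrightarrow> g \<in> B \<Longrightarrow> i \<notin> I \<Longrightarrow> f i = g i"
  shows "(k + 1) ^ card I * card X * card B \<le> (2 * k) ^ card I * card (X + B)"
  using assms
proof (induction I arbitrary: X B rule: finite_induct)
  case empty
  have "card X \<le> 1" "card B \<le> 1"
    using empty by (auto simp: card_le_Suc0_iff_eq fun_eq_iff)
  show ?case
  proof (cases "X = {} \<or> B = {}")
    case False
    then have "X + B \<noteq> {}" by (auto simp: set_plus_def)
    moreover have "finite (X + B)" using empty by (simp add: finite_set_plus)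
    ultimately have "1 \<le> card (X + B)" by (simp add: Suc_le_eq card_gt_0_iff)
    moreover have "card X * card B \<le> 1 * 1"
      using \<open>card X \<le> 1\<close> \<open>card B \<le> 1\<close> by (intro mult_mono) auto
    ultimately show ?thesis by simp
  qed auto
next
  case (insert p I)
  define Xs where "Xs j = {f \<in> X. f p = j}" for j
  define Bs where "Bs j = {f \<in> B. f p = j}" for j
  define Ss where "Ss j = {f \<in> X + B. f p = j}" for j
  have finS: "finite (X + B)" using insert.prems by (simp add: finite_set_plus)
  \<comment> \<open>Fixing the value at \<open>p\<close> freezes that coordinate as well, so the
    induction hypothesis applies to slices. Values at \<open>p\<close> add up, so
    \<open>Xs i + Bs j\<close> lies in \<open>Ss (i + j)\<close>.\<close>
  have slice: "(k + 1) ^ card I * card (Xs i) * card (Bs j) \<le> (2 * k) ^ card I * card (Ss (i + j))"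
    for i j
  proof -
    have "(k + 1) ^ card I * card (Xs i) * card (Bs j) \<le> (2 * k) ^ card I * card (Xs i + Bs j)"
    proof (rule insert.IH)
      show "f l = g l" if "f \<in> Xs i" "g \<in> Xs i" "l \<notin> I" for f g l
        using that insert.prems(6)[of f g l] by (cases "l = p") (auto simp: Xs_def)
      show "f l = g l" if "f \<in> Bs j" "g \<in> Bs j" "l \<notin> I" for f g l
        using that insert.prems(7)[of f g l] by (cases "l = p") (auto simp: Bs_def)
    qed (use insert.prems in \<open>auto simp: Xs_def Bs_def\<close>)
    also have "card (Xs i + Bs j) \<le> card (Ss (i + j))"
      using finS by (intro card_mono) (auto simp: Ss_def Xs_def Bs_def set_plus_def)
    finally show ?thesis by simp
  qed
  have X: "card X = (\<Sum>i<k. card (Xs i))"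
    unfolding Xs_def using insert.prems by (intro card_eq_sum_slices) auto
  have "card B = (\<Sum>i<2. card (Bs i))"
    unfolding Bs_def using insert.prems by (intro card_eq_sum_slices) auto
  then have B: "card B = card (Bs 0) + card (Bs 1)" by (simp add: numeral_2_eq_2)
  have S: "card (X + B) = (\<Sum>i\<le>k. card (Ss i))"
    unfolding Ss_def
  proof (intro card_eq_sum_slices finS)
    fix h assume "h \<in> X + B"
    then obtain f g where "f \<in> X" "g \<in> B" "h = f + g" by (auto simp: set_plus_def)
    then show "h p \<in> {..k}" using insert.prems(4)[of f p] insert.prems(5)[of g p] by auto
  qed simp
  have slice': "real ((k + 1) ^ card I) * real (card (Xs i)) * real (card (Bs j))
      \<le> real ((2 * k) ^ card I) * real (card (Ss (i + j)))" for i j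
    using slice[of i j] by (metis of_nat_le_iff of_nat_mult)
  \<comment> \<open>The factors from the induction hypothesis are absorbed into \<open>x\<close> and
    \<open>t\<close>; the one-dimensional inequality then supplies the factor belonging to
    \<open>p\<close>.\<close>
  have "real (k + 1) * (\<Sum>i<k. real ((k + 1) ^ card I) * real (card (Xs i)))
        * (real (card (Bs 0)) + real (card (Bs 1)))
      \<le> real (2 * k) * (\<Sum>i\<le>k. real ((2 * k) ^ card I) * real (card (Ss i)))"
    using slice'[of _ 0] slice'[of _ 1] \<open>0 < k\<close> by (intro sup_convolution_sum_ge) auto
  also have "\<dots> = real ((2 * k) ^ card (insert p I) * card (X + B))"
    using insert.hyps by (simp add: S sum_distrib_left mult_ac)
  also have "real (k + 1) * (\<Sum>i<k. real ((k + 1) ^ card I) * real (card (Xs i)))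
        * (real (card (Bs 0)) + real (card (Bs 1)))
      = real ((k + 1) ^ card (insert p I) * card X * card B)"
    using insert.hyps unfolding sum_distrib_left[symmetric] by (simp add: X B algebra_simps)
  finally show ?case by (simp only: of_nat_le_iff)
qed

section \<open>Boxes and iterated sumsets\<close>

text \<open>The value 0 outside \<open>I\<close>, unlike the \<open>undefined\<close> of extensional
  functions, is preserved by pointwise addition, as \<open>box_add\<close> needs.\<close>

definition box :: "'a set \<Rightarrow> nat \<Rightarrow> ('a \<Rightarrow> nat) set" where
  "box I k = {f. (\<forall>i\<in>I. f i \<le> k) \<and> (\<forall>i. i \<notin> I \<longrightarrow> f i = 0)}"

lemma box_subset_image:
  "box I k \<subseteq> (\<lambda>f i. if i \<in> I then f i else 0) ` (I \<rightarrow>\<^sub>E {..k})"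
proof
  fix f assume "f \<in> box I k"
  then show "f \<in> (\<lambda>f i. if i \<in> I then f i else 0) ` (I \<rightarrow>\<^sub>E {..k})"
    by (intro image_eqI[of _ _ "restrict f I"]) (auto simp: box_def)
qed

lemma finite_box: "finite I \<Longrightarrow> finite (box I k)"
  by (rule finite_subset[OF box_subset_image]) (intro finite_imageI finite_PiE, auto)

lemma card_box_le:
  assumes "finite I"
  shows "card (box I k) \<le> (k + 1) ^ card I"
proof -
  have fin: "finite (I \<rightarrow>\<^sub>E {..k})" using assms by (intro finite_PiE) auto
  have "card (box I k) \<le> card (I \<rightarrow>\<^sub>E {..k})"
    by (rule surj_card_le[OF fin box_subset_image])
  also have "\<dots> = (k + 1) ^ card I" using assms by (simp add: card_PiE)
  finally show ?thesis .
qed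

lemma box_add: "X \<subseteq> box I k \<Longrightarrow> Y \<subseteq> box I l \<Longrightarrow> X + Y \<subseteq> box I (k + l)"
  unfolding box_def set_plus_def by (fastforce intro: add_mono)

fun nfold_sumset :: "nat \<Rightarrow> 'a::comm_monoid_add set \<Rightarrow> 'a set" where
  "nfold_sumset 0 A = {0}"
| "nfold_sumset (Suc k) A = nfold_sumset k A + A"

lemma nfold_sumset_box: "A \<subseteq> box I 1 \<Longrightarrow> nfold_sumset k A \<subseteq> box I k"
proof (induction k)
  case 0
  then show ?case by (auto simp: box_def)
next
  case (Suc k)
  then show ?case using box_add[of "nfold_sumset k A" I k A 1] by simp
qed

text \<open>Adding \<open>A\<close> to the \<open>j\<close>-fold sumset gains
  \<open>((j + 2) / (2 * (j + 1))) ^ card I * card A\<close>. Over \<open>j < k\<close> the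
  fractions telescope to \<open>(k + 1) / 2 ^ k\<close>.\<close>

lemma card_nfold_sumset_ge:
  assumes I: "finite I" and A: "A \<subseteq> box I 1"
  shows "(k + 1) ^ card I * card A ^ k \<le> 2 ^ (k * card I) * card (nfold_sumset k A)"
proof (induction k)
  case 0
  then show ?case by simp
next
  case (Suc k)
  let ?X = "nfold_sumset k A"
  have X: "?X \<subseteq> box I k" by (rule nfold_sumset_box[OF A])
  have fin: "finite ?X" "finite A"
    using X A finite_box[OF I] finite_subset by blast+
  \<comment> \<open>Entries of \<open>?X\<close> range over the \<open>Suc k\<close> values
    \<open>0..k\<close>, hence the sumset bound is used with \<open>Suc k\<close>.\<close>
  have step: "(Suc k + 1) ^ card I * card ?X * card A \<le> (2 * Suc k) ^ card I * card (?X + A)"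
  proof (rule card_box_sumset_ge[OF I _ fin])
    show "f i < Suc k" if "f \<in> ?X" "i \<in> I" for f i
      using X that by (auto simp: box_def less_Suc_eq_le)
    show "f i < 2" if "f \<in> A" "i \<in> I" for f i
      using A that by (fastforce simp: box_def)
    show "f i = g i" if "f \<in> ?X" "g \<in> ?X" "i \<notin> I" for f g i
      using subsetD[OF X that(1)] subsetD[OF X that(2)] that(3) by (simp add: box_def)
    show "f i = g i" if "f \<in> A" "g \<in> A" "i \<notin> I" for f g i
      using subsetD[OF A that(1)] subsetD[OF A that(2)] that(3) by (simp add: box_def)
  qed simp
  \<comment> \<open>The extra factor \<open>(k + 1) ^ card I\<close> makes the induction hypothesis
    applicable without division; it is cancelled at the end.\<close>
  have "(k + 1) ^ card I * ((Suc k + 1) ^ card I * card A ^ Suc k)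
      = ((k + 1) ^ card I * card A ^ k) * ((Suc k + 1) ^ card I * card A)"
    by simp
  also have "\<dots> \<le> (2 ^ (k * card I) * card ?X) * ((Suc k + 1) ^ card I * card A)"
    using Suc.IH by (rule mult_right_mono) simp
  also have "\<dots> \<le> 2 ^ (k * card I) * ((2 * Suc k) ^ card I * card (?X + A))"
    using mult_left_mono[OF step, of "2 ^ (k * card I)"] by (simp only: mult_ac)
  also have "\<dots> = (k + 1) ^ card I * (2 ^ (Suc k * card I) * card (?X + A))"
    unfolding power_mult_distrib by (simp add: power_add mult_ac)
  finally show ?case by (subst (asm) mult_le_cancel1) simp
qed

section \<open>Counting sums of a fibre and a separated set\<close>

text \<open>Sums are represented uniquely: applying \<open>\<phi>\<close> to
  \<open>f + g = f' + g'\<close> and cancelling \<open>c\<close> leaves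
  \<open>\<phi> g = \<phi> g'\<close>, so \<open>g = g'\<close> and then
  \<open>f = f'\<close>.\<close>

lemma card_sumset_eq_if_separated:
  fixes \<phi> :: "'a::cancel_comm_monoid_add \<Rightarrow> 'b::cancel_comm_monoid_add"
  assumes add: "\<And>f g. \<phi> (f + g) = \<phi> f + \<phi> g"
    and X: "\<And>f. f \<in> X \<Longrightarrow> \<phi> f = c" and B: "inj_on \<phi> B"
  shows "card (X + B) = card X * card B"
proof -
  have "inj_on (\<lambda>(f, g). f + g) (X \<times> B)"
  proof (rule inj_onI, clarify)
    fix f g f' g' assume *: "f \<in> X" "g \<in> B" "f' \<in> X" "g' \<in> B" "f + g = f' + g'"
    then have "\<phi> g = \<phi> g'" using add X by (metis add_left_cancel)
    then have "g = g'" using B * by (auto dest: inj_onD)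
    then show "f = f' \<and> g = g'" using * by simp
  qed
  then show ?thesis by (simp add: set_plus_image card_image card_cartesian_product)
qed

lemma fibre_sums_bound:
  fixes \<phi> :: "('a \<Rightarrow> nat) \<Rightarrow> int"
  assumes I: "finite I" and A: "A \<subseteq> box I 1" and B: "B \<subseteq> box I 1"
    and add: "\<And>f g. \<phi> (f + g) = \<phi> f + \<phi> g"
    and const: "\<And>f. f \<in> A \<Longrightarrow> \<phi> f = c" and inj: "inj_on \<phi> B"
  shows "(k + 1) ^ card I * card A ^ k * card B \<le> 2 ^ (k * card I) * (k + 2) ^ card I"
proof -
  let ?X = "nfold_sumset k A"
  have "\<phi> f = of_nat k * c" if "f \<in> ?X" for f
    using that
  proof (induction k arbitrary: f)
    case 0
    \<comment> \<open>Additivity at \<open>0 + 0\<close> forces \<open>\<phi> 0 = 0\<close>.\<close>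
    then show ?case using add[of 0 0] by (simp del: zero_fun_apply)
  next
    case (Suc k)
    then obtain g h where "g \<in> nfold_sumset k A" "h \<in> A" "f = g + h"
      by (auto simp: set_plus_def)
    then show ?case using Suc.IH[of g] const[of h] add[of g h] by (simp add: algebra_simps del: plus_fun_apply)
  qed
  then have "card ?X * card B = card (?X + B)"
    using card_sumset_eq_if_separated[of \<phi> ?X _ B] add inj by metis
  also have "\<dots> \<le> card (box I (k + 1))"
    using box_add[OF nfold_sumset_box[OF A] B] by (intro card_mono finite_box I)
  also have "\<dots> \<le> (k + 2) ^ card I" using card_box_le[OF I, of "k + 1"] by simp
  finally have XB: "card ?X * card B \<le> (k + 2) ^ card I" .
  have "(k + 1) ^ card I * card A ^ k * card B \<le> 2 ^ (k * card I) * card ?X * card B"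
    using card_nfold_sumset_ge[OF I A] by (rule mult_right_mono) simp
  also have "\<dots> \<le> 2 ^ (k * card I) * (k + 2) ^ card I"
    unfolding mult.assoc using XB by (rule mult_left_mono) simp
  finally show ?thesis .
qed

section \<open>From subsets to 0/1 vectors\<close>

lemma weight_eq_sum_indicator:
  "finite I \<Longrightarrow> X \<subseteq> I \<Longrightarrow> weight w X = (\<Sum>i\<in>I. w i * int (indicator X i))"
  unfolding weight_def by (simp add: indicator_def if_distrib sum.If_cases Int_absorb1 cong: if_cong)

lemma inj_indicator: "inj (indicator :: 'a set \<Rightarrow> 'a \<Rightarrow> nat)"
  by (rule injI) (simp add: fun_eq_iff indicator_def set_eq_iff of_bool_eq_iff)

lemma card_subset_sums_le:
  "(k + 1) ^ n * max_fibre n w ^ k * card (subset_sums n w) \<le> 2 ^ (k * n) * (k + 2) ^ n"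
proof -
  let ?I = "{1..n}"
  define \<phi> :: "(nat \<Rightarrow> nat) \<Rightarrow> int" where "\<phi> f = (\<Sum>i\<in>?I. w i * int (f i))" for f
  have \<phi>: "\<phi> (indicator X) = weight w X" if "X \<subseteq> ?I" for X
    using that by (simp add: \<phi>_def weight_eq_sum_indicator[of ?I])
  obtain v where v: "max_fibre n w = card {X. X \<subseteq> ?I \<and> weight w X = v}"
    using Max_in[OF finite_range_fibre_card[of n w]] unfolding max_fibre_def by auto
  define F where "F = {X. X \<subseteq> ?I \<and> weight w X = v}"
  have sums: "subset_sums n w = weight w ` Pow ?I" by (auto simp: subset_sums_def)
  \<comment> \<open>\<open>R\<close> picks one subset for each attained weight, so
    \<open>weight w\<close> is injective on it.\<close>
  obtain R where R: "R \<subseteq> Pow ?I" "subset_sums n w = weight w ` R" "inj_on (weight w) R"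
    unfolding sums using subset_image_inj[of "weight w ` Pow ?I" "weight w" "Pow ?I"] by auto
  have ind_box: "indicator X \<in> box ?I 1" if "X \<subseteq> ?I" for X
    using that by (auto simp: box_def indicator_def)
  have "(k + 1) ^ card ?I * card ((indicator :: nat set \<Rightarrow> nat \<Rightarrow> nat) ` F) ^ k
      * card ((indicator :: nat set \<Rightarrow> nat \<Rightarrow> nat) ` R) \<le> 2 ^ (k * card ?I) * (k + 2) ^ card ?I"
  proof (rule fibre_sums_bound)
    show "\<phi> (f + g) = \<phi> f + \<phi> g" for f g
      by (simp add: \<phi>_def sum.distrib algebra_simps)
    show "\<phi> f = v" if "f \<in> indicator ` F" for f using that \<phi> by (auto simp: F_def)
    show "inj_on \<phi> (indicator ` R)"
    proof (rule inj_on_imageI)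
      have "inj_on (\<phi> \<circ> indicator) R \<longleftrightarrow> inj_on (weight w) R"
        using R(1) by (intro inj_on_cong) (simp add: \<phi> subset_iff)
      then show "inj_on (\<phi> \<circ> indicator) R" using R(3) by simp
    qed
    show "indicator ` R \<subseteq> box ?I 1" using R(1) by (intro image_subsetI ind_box) auto
    show "indicator ` F \<subseteq> box ?I 1" by (intro image_subsetI ind_box) (auto simp: F_def)
  qed (rule finite_atLeastAtMost)
  moreover have "card ((indicator :: nat set \<Rightarrow> nat \<Rightarrow> nat) ` F) = max_fibre n w"
    using v by (simp add: F_def card_image inj_on_subset[OF inj_indicator])
  moreover have "card ((indicator :: nat set \<Rightarrow> nat \<Rightarrow> nat) ` R) = card (subset_sums n w)"
    using R by (simp add: card_image inj_on_subset[OF inj_indicator])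
  ultimately show ?thesis by simp
qed

section \<open>Choice of \<open>k\<close> and the final estimate\<close>

lemma one_plus_le_two_powr:
  fixes x :: real
  assumes "0 \<le> x"
  shows "1 + x \<le> 2 powr (2 * x)"
proof -
  have "1 / 2 \<le> ln (2 :: real)" using exp_half_le2 ln_ge_iff[of 2 "1 / 2"] by simp
  then have "x \<le> 2 * x * ln 2" using mult_left_mono[of "1 / 2" "ln 2" "2 * x"] assms by simp
  then show ?thesis
    using order_trans[OF exp_ge_add_one_self[of x], of "exp (2 * x * ln 2)"]
    by (simp add: powr_def)
qed

lemma card_subset_sums_powr_le:
  assumes \<epsilon>: "0 < \<epsilon>" and \<beta>: "real (max_fibre n w) \<ge> 2 powr ((1 - \<epsilon>) * real n)"
  shows "real (card (subset_sums n w)) \<le> 2 powr (3 * sqrt \<epsilon> * real n)"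
proof -
  \<comment> \<open>This \<open>k\<close> balances the two losses in the exponent:
    \<open>k * \<epsilon>\<close> from the density of the fibre and \<open>2 / (k + 1)\<close> from
    the ratio \<open>(k + 2) / (k + 1)\<close>. They are at most \<open>sqrt \<epsilon>\<close> and
    \<open>2 * sqrt \<epsilon>\<close>, hence the constant 3. For \<open>\<epsilon> > 1\<close> this
    gives \<open>k = 0\<close>, and the estimates still hold.\<close>
  define k where "k = nat \<lfloor>1 / sqrt \<epsilon>\<rfloor>"
  define s where "s = real (card (subset_sums n w))"
  have s: "0 \<le> s" by (simp add: s_def)
  have k1: "real k \<le> 1 / sqrt \<epsilon>" and k2: "1 / sqrt \<epsilon> \<le> real k + 1"
    using \<epsilon> unfolding k_def by auto
  have "real k * \<epsilon> \<le> 1 / sqrt \<epsilon> * \<epsilon>" using k1 \<epsilon> by (intro mult_right_mono) auto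
  then have k1': "real k * \<epsilon> \<le> sqrt \<epsilon>" using \<epsilon> by (simp add: real_div_sqrt)
  have k2': "1 / (real k + 1) \<le> sqrt \<epsilon>" using k2 \<epsilon> by (simp add: field_simps)
  have "(real k + 1) ^ n * (2 powr ((1 - \<epsilon>) * real n)) ^ k * s
      \<le> (real k + 1) ^ n * real (max_fibre n w) ^ k * s"
    using \<beta> s by (intro mult_right_mono mult_left_mono power_mono) auto
  also have "\<dots> = real ((k + 1) ^ n * max_fibre n w ^ k * card (subset_sums n w))"
    by (simp add: s_def add.commute)
  also have "\<dots> \<le> real (2 ^ (k * n) * (k + 2) ^ n)"
    using card_subset_sums_le[of k n w] by (simp only: of_nat_le_iff)
  also have "\<dots> = 2 powr (real k * real n) * (real k + 2) ^ n"
    by (simp add: powr_realpow[symmetric] add.commute)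
  also have "(real k + 2) ^ n = (real k + 1) ^ n * (1 + 1 / (real k + 1)) ^ n"
    by (simp add: power_mult_distrib[symmetric] field_simps)
  also have "2 powr (real k * real n) * ((real k + 1) ^ n * (1 + 1 / (real k + 1)) ^ n)
      = (real k + 1) ^ n * (2 powr (real k * real n) * (1 + 1 / (real k + 1)) ^ n)"
    by simp
  finally have "(2 powr ((1 - \<epsilon>) * real n)) ^ k * s
      \<le> 2 powr (real k * real n) * (1 + 1 / (real k + 1)) ^ n"
    by (simp add: mult.assoc)
  moreover have "(2 powr ((1 - \<epsilon>) * real n)) ^ k = 2 powr (real k * real n) * 2 powr (- (real k * \<epsilon> * real n))"
    by (simp add: powr_power powr_add[symmetric] algebra_simps)
  ultimately have "2 powr (- (real k * \<epsilon> * real n)) * s \<le> (1 + 1 / (real k + 1)) ^ n"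
    by (simp add: mult.assoc)
  then have "s \<le> 2 powr (real k * \<epsilon> * real n) * (1 + 1 / (real k + 1)) ^ n"
    by (simp add: powr_minus field_simps)
  also have "(1 + 1 / (real k + 1)) ^ n \<le> (2 powr (2 * (1 / (real k + 1)))) ^ n"
    by (intro power_mono one_plus_le_two_powr) auto
  also have "\<dots> = 2 powr (2 * (1 / (real k + 1)) * real n)"
    by (simp add: powr_power mult.commute)
  also have "2 powr (real k * \<epsilon> * real n) * 2 powr (2 * (1 / (real k + 1)) * real n)
      = 2 powr ((real k * \<epsilon> + 2 * (1 / (real k + 1))) * real n)"
    by (simp add: powr_add[symmetric] distrib_right)
  also have "\<dots> \<le> 2 powr (3 * sqrt \<epsilon> * real n)"
    using k1' k2' by (intro powr_mono mult_right_mono) auto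
  finally show ?thesis by (simp add: s_def)
qed

theorem theorem2:
  shows "\<exists>\<delta> :: real \<Rightarrow> real.
    \<delta> \<in> O[at_right 0](\<lambda>\<epsilon>. log 2 (log 2 (1 / \<epsilon>)) / sqrt (log 2 (1 / \<epsilon>))) \<and>
    (\<forall>\<epsilon>>0. \<forall>(n :: nat) (w :: nat \<Rightarrow> int).
       real (max_fibre n w) \<ge> 2 powr ((1 - \<epsilon>) * real n) \<longrightarrow>
       real (card (subset_sums n w)) \<le> 2 powr (\<delta> \<epsilon> * real n))"
proof (intro exI conjI allI impI)
  \<comment> \<open>A power of \<open>\<epsilon>\<close> tends to 0 faster than any negative power
    of \<open>log 2 (1 / \<epsilon>)\<close>.\<close>
  show "(\<lambda>\<epsilon>. 3 * sqrt \<epsilon>) \<in> O[at_right 0](\<lambda>\<epsilon>. log 2 (log 2 (1 / \<epsilon>)) / sqrt (log 2 (1 / \<epsilon>)))"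
    by real_asymp
qed (rule card_subset_sums_powr_le)

end
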